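(* Let $a\ge 1$, let $p=(p_1,\dots,p_a)$ be a probability vector with all $p_s>0$, let $n\ge 2$ and $0\le k\le n-1$ be integers, and let $Y_{\geq k, n}^{p}$ denote the number of nodes with at least $k$ descendants in a $p$-biased recursive tree of order $n$. Then $$\mathbb{E}[Y_{\geq k, n}^{p}] = (n-k-1)\sum_{s=1}^{a} p_s \Big(\sum_{r=s}^{a} p_r \Big)^k +1.$$ Moreover, if $p$ is the uniform distribution over $[a]$, $a\ge2$, and $Y_{\ge k,n}^{a}$ denotes the corresponding number for an $a$-recursive tree of order $n$, then $$\mathbb{E}[Y_{\geq k, n}^{a}] = (n-k-1)\, \frac{1}{a^{k+1}} \sum_{s=1}^{a} s^k +1,$$ and in particular, as $a \to \infty$ (with $n,k$ fixed), $$\mathbb{E}[Y_{\geq k, n}^{a}] \longrightarrow \frac{n}{k+1}.$$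
   Context: $[a]=\{1,\dots,a\}$. $p$-biased riffle shuffle of $\{2,\dots,n\}$: start with the deck $2,3,\dots,n$ in increasing order; cut it into $a$ consecutive piles whose sizes $(b_1,\dots,b_a)$ (pile 1 consisting of the $b_1$ smallest cards, etc.) have the multinomial$(n-1;p)$ distribution; then choose uniformly one of the $\binom{n-1}{b_1,\dots,b_a}$ ways of interleaving the piles keeping the cards of each pile in their original order. The resulting arrangement $\gamma=(\gamma(2),\dots,\gamma(n))$ is the $p$-biased riffle shuffle permutation of $\{2,\dots,n\}$, where $\gamma(j)$ is the card in position $j$. $p$-biased recursive tree ($p$-BRT) of order $n$: the random rooted tree on vertices $1,\dots,n$ with root $1$, obtained by attaching each node $i\ge 2$ to the rightmost element $j$ of $\gamma$ which precedes $i$ and satisfies $j<i$; if there is no such $j$, the parent of $i$ is $1$. When $p$ is uniform over $[a]$, $a\ge2$, it is called an $a$-recursive tree ($a$-RT). A descendant of a vertex $v$ is any vertex that is a child of $v$ or a descendant of a child of $v$ (so $v$ is not its own descendant). *)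

theory Defs
  imports "HOL-Probability.Probability" "HOL-Library.Sublist"
    "HOL-Combinatorics.Multiset_Permutations"
begin

definition compositions :: "'s set \<Rightarrow> nat \<Rightarrow> ('s \<Rightarrow> nat) set" where
  "compositions S m = {b. (\<forall>s. s \<notin> S \<longrightarrow> b s = 0) \<and> sum b S = m}"

definition multinomial_mass :: "'s set \<Rightarrow> nat \<Rightarrow> ('s \<Rightarrow> real) \<Rightarrow> ('s \<Rightarrow> nat) \<Rightarrow> real" where
  "multinomial_mass S m p b =
     (if b \<in> compositions S m then fact m / (\<Prod>s\<in>S. fact (b s)) * (\<Prod>s\<in>S. p s ^ b s) else 0)"

text \<open>Only meaningful if \<^term>\<open>p\<close> is a probability vector on the finite set \<^term>\<open>S\<close>; see
  \<open>pmf_multinomial_pmf\<close> below.\<close>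

definition multinomial_pmf :: "'s set \<Rightarrow> nat \<Rightarrow> ('s \<Rightarrow> real) \<Rightarrow> ('s \<Rightarrow> nat) pmf" where
  "multinomial_pmf S m p = embed_pmf (multinomial_mass S m p)"

lemma compositions_empty: "compositions {} m = (if m = 0 then {\<lambda>_. 0} else {})"
  by (auto simp: compositions_def)

lemma compositions_insert:
  assumes "finite S" "x \<notin> S"
  shows "compositions (insert x S) m = (\<Union>j\<le>m. (\<lambda>b. b(x := j)) ` compositions S (m - j))"
proof (intro set_eqI iffI)
  fix b assume b: "b \<in> compositions (insert x S) m"
  have "sum (b(x := 0)) S = sum b S"
    using assms by (intro sum.cong) auto
  moreover have "b x + sum b S = m"
    using b assms by (simp add: compositions_def)
  ultimately have "b(x := 0) \<in> compositions S (m - b x)" and "b x \<le> m"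
    using b by (auto simp: compositions_def)
  moreover have "b = (b(x := 0))(x := b x)" by simp
  ultimately show "b \<in> (\<Union>j\<le>m. (\<lambda>b. b(x := j)) ` compositions S (m - j))"
    by blast
next
  fix b assume "b \<in> (\<Union>j\<le>m. (\<lambda>b. b(x := j)) ` compositions S (m - j))"
  then obtain j c where jc: "j \<le> m" "c \<in> compositions S (m - j)" "b = c(x := j)" by blast
  have "sum b S = sum c S"
    using assms jc by (intro sum.cong) auto
  then show "b \<in> compositions (insert x S) m"
    using jc assms by (auto simp: compositions_def)
qed

lemma finite_compositions: "finite S \<Longrightarrow> finite (compositions S m)"
proof (induction S arbitrary: m rule: finite_induct)
  case empty
  then show ?case by (simp add: compositions_empty)
next
  case (insert x S)
  then show ?case by (simp add: compositions_insert)
qed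

lemma multinomial_theorem:
  fixes p :: "'s \<Rightarrow> real"
  assumes "finite S"
  shows "(\<Sum>b\<in>compositions S m. fact m / (\<Prod>s\<in>S. fact (b s)) * (\<Prod>s\<in>S. p s ^ b s)) = sum p S ^ m"
  using assms
proof (induction S arbitrary: m rule: finite_induct)
  case empty
  then show ?case by (simp add: compositions_empty)
next
  case (insert x S)
  let ?t = "\<lambda>S m b. fact m / (\<Prod>s\<in>S. fact (b s)) * (\<Prod>s\<in>S. p s ^ b s)"
  let ?I = "\<lambda>j. (\<lambda>b. b(x := j)) ` compositions S (m - j)"
  have inj: "inj_on (\<lambda>b. b(x := j)) (compositions S i)" for i j
  proof (rule inj_onI)
    fix b c assume *: "b \<in> compositions S i" "c \<in> compositions S i" "b(x := j) = c(x := j)"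
    show "b = c"
    proof
      fix y show "b y = c y"
      proof (cases "y = x")
        case True
        then show ?thesis using * insert.hyps by (auto simp: compositions_def)
      next
        case False
        then show ?thesis using fun_cong[OF *(3), of y] by simp
      qed
    qed
  qed
  have disj: "?I i \<inter> ?I j = {}" if "i \<noteq> j" for i j
  proof -
    have *: "b x = i" if "b \<in> ?I i" for b i using that by auto
    have False if "b \<in> ?I i" "b \<in> ?I j" for b
      using *[OF that(1)] *[OF that(2)] \<open>i \<noteq> j\<close> by simp
    then show ?thesis by (intro equals0I) (elim IntE)
  qed
  have term_eq: "?t (insert x S) m (b(x := j)) = real (m choose j) * p x ^ j * ?t S (m - j) b"
    if "j \<le> m" for j b
  proof -
    have "(\<Prod>s\<in>S. fact ((b(x := j)) s)) = (\<Prod>s\<in>S. fact (b s) :: real)"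
         "(\<Prod>s\<in>S. p s ^ (b(x := j)) s) = (\<Prod>s\<in>S. p s ^ b s)"
      using insert.hyps by (auto intro!: prod.cong)
    moreover have "real (m choose j) = fact m / (fact j * fact (m - j))"
      using that by (rule binomial_fact)
    moreover have "(\<Prod>s\<in>insert x S. fact ((b(x := j)) s))
        = (fact j * (\<Prod>s\<in>S. fact ((b(x := j)) s)) :: real)"
      "(\<Prod>s\<in>insert x S. p s ^ (b(x := j)) s) = p x ^ j * (\<Prod>s\<in>S. p s ^ (b(x := j)) s)"
      using insert.hyps by simp_all
    ultimately show ?thesis by simp
  qed
  have "(\<Sum>b\<in>compositions (insert x S) m. ?t (insert x S) m b)
      = (\<Sum>j\<le>m. \<Sum>b\<in>?I j. ?t (insert x S) m b)"
    unfolding compositions_insert[OF insert.hyps]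
    by (rule sum.UNION_disjoint; intro ballI impI finite_atMost finite_imageI
        finite_compositions[OF insert.hyps(1)] disj)
  also have "\<dots> = (\<Sum>j\<le>m. \<Sum>b\<in>compositions S (m - j). ?t (insert x S) m (b(x := j)))"
    by (simp only: sum.reindex[OF inj] o_def)
  also have "\<dots> = (\<Sum>j\<le>m. real (m choose j) * p x ^ j * sum p S ^ (m - j))"
  proof (rule sum.cong[OF refl])
    fix j assume "j \<in> {..m}"
    then have "j \<le> m" by simp
    then show "(\<Sum>b\<in>compositions S (m - j). ?t (insert x S) m (b(x := j)))
        = real (m choose j) * p x ^ j * sum p S ^ (m - j)"
      by (simp only: term_eq sum_distrib_left[symmetric] insert.IH)
  qed
  also have "\<dots> = (p x + sum p S) ^ m"
    by (simp add: binomial_ring)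
  finally show ?case using insert.hyps by simp
qed

lemma pmf_multinomial_pmf:
  assumes "finite S" "\<And>s. s \<in> S \<Longrightarrow> 0 \<le> p s" "sum p S = 1"
  shows "pmf (multinomial_pmf S m p) b = multinomial_mass S m p b"
  unfolding multinomial_pmf_def
proof (rule pmf_embed_pmf)
  show nonneg: "0 \<le> multinomial_mass S m p b" for b
    using assms
    by (auto simp: multinomial_mass_def intro!: mult_nonneg_nonneg divide_nonneg_nonneg prod_nonneg)
  have fin: "finite (compositions S m)"
    using assms by (simp add: finite_compositions)
  have "(\<integral>\<^sup>+b. ennreal (multinomial_mass S m p b) \<partial>count_space UNIV)
      = (\<integral>\<^sup>+b. ennreal (multinomial_mass S m p b) \<partial>count_space (compositions S m))"
    by (rule nn_integral_count_space_eq) (auto simp: multinomial_mass_def)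
  also have "\<dots> = ennreal (\<Sum>b\<in>compositions S m. multinomial_mass S m p b)"
    using fin nonneg by (simp add: nn_integral_count_space_finite)
  also have "(\<Sum>b\<in>compositions S m. multinomial_mass S m p b) = 1"
    using multinomial_theorem[OF assms(1), of m p] assms(3) by (simp add: multinomial_mass_def)
  finally show "(\<integral>\<^sup>+b. ennreal (multinomial_mass S m p b) \<partial>count_space UNIV) = 1"
    by simp
qed

text \<open>The deck \<open>2, \<dots>, n\<close> is cut into consecutive piles, pile \<open>s\<close> having \<open>b s\<close> cards.\<close>

definition pile :: "(nat \<Rightarrow> nat) \<Rightarrow> nat \<Rightarrow> nat list" where
  "pile b s = [2 + (\<Sum>r=1..<s. b r) ..< 2 + (\<Sum>r=1..s. b r)]"

text \<open>As the cards are distinct, a way of interleaving the piles is the same thing as the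
  resulting arrangement of the deck.  Arrangements are lists: the card in position \<open>j\<close>
  (where \<open>2 \<le> j \<le> n\<close>) is \<open>\<gamma> ! (j - 2)\<close>.\<close>

definition interleavings :: "nat \<Rightarrow> nat \<Rightarrow> (nat \<Rightarrow> nat) \<Rightarrow> nat list set" where
  "interleavings n a b = {\<gamma> \<in> permutations_of_set {2..n}. \<forall>s\<in>{1..a}. subseq (pile b s) \<gamma>}"

lemma deck_in_interleavings:
  assumes "b \<in> compositions {1..a} (n - 1)" "n \<ge> 1"
  shows "[2..<Suc n] \<in> interleavings n a b"
proof -
  have "subseq (pile b s) [2..<Suc n]" if "s \<in> {1..a}" for s
  proof -
    let ?l = "2 + (\<Sum>r=1..<s. b r)" and ?u = "2 + (\<Sum>r=1..s. b r)"
    have "(\<Sum>r=1..s. b r) \<le> (\<Sum>r=1..a. b r)"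
      using that by (intro sum_mono2) auto
    then have u: "?u \<le> Suc n"
      using assms by (simp add: compositions_def)
    have l: "?l \<le> ?u" by (intro add_left_mono sum_mono2) auto
    have "[2..<Suc n] = [2..<?l] @ [?l..<?u] @ [?u..<Suc n]"
      using l u by (metis le_add1 le_add_diff_inverse order_trans upt_add_eq_append)
    then show ?thesis
      unfolding pile_def by (metis list_emb_append2 subseq_rev_drop_many subseq_order.order_refl)
  qed
  then show ?thesis
    by (auto simp: interleavings_def permutations_of_set_def)
qed

definition riffle_shuffle_pmf :: "nat \<Rightarrow> (nat \<Rightarrow> real) \<Rightarrow> nat \<Rightarrow> nat list pmf" where
  "riffle_shuffle_pmf a p n =
     bind_pmf (multinomial_pmf {1..a} (n - 1) p) (\<lambda>b. pmf_of_set (interleavings n a b))"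

definition brt_parent :: "nat list \<Rightarrow> nat \<Rightarrow> nat" where
  "brt_parent \<gamma> i =
     (let js = filter (\<lambda>j. j < i) (takeWhile (\<lambda>j. j \<noteq> i) \<gamma>) in if js = [] then 1 else last js)"

text \<open>A tree on \<open>1, \<dots>, n\<close> with root \<open>1\<close> is represented by its set of (parent, child) pairs.\<close>

definition brt_tree :: "nat \<Rightarrow> nat list \<Rightarrow> (nat \<times> nat) set" where
  "brt_tree n \<gamma> = {(brt_parent \<gamma> i, i) |i. i \<in> {2..n}}"

definition brt_pmf :: "nat \<Rightarrow> (nat \<Rightarrow> real) \<Rightarrow> nat \<Rightarrow> (nat \<times> nat) set pmf" where
  "brt_pmf a p n = map_pmf (brt_tree n) (riffle_shuffle_pmf a p n)"

definition art_pmf :: "nat \<Rightarrow> nat \<Rightarrow> (nat \<times> nat) set pmf" where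
  "art_pmf a n = brt_pmf a (\<lambda>_. 1 / real a) n"

definition descendants :: "(nat \<times> nat) set \<Rightarrow> nat \<Rightarrow> nat set" where
  "descendants T v = {u. (v, u) \<in> T\<^sup>+}"

definition num_ge_descendants :: "nat \<Rightarrow> nat \<Rightarrow> (nat \<times> nat) set \<Rightarrow> nat" where
  "num_ge_descendants k n T = card {v \<in> {1..n}. k \<le> card (descendants T v)}"

end

theory Submission
  imports Defs
begin

text \<open>
  Put the root in front of the shuffled deck and write \<open>\<delta> = 1, \<gamma>(2), \<dots>, \<gamma>(n)\<close>.  The parent of an
  entry of \<open>\<delta>\<close> is the nearest smaller entry to its left, so the descendants of an entry are the
  entries following it up to, but excluding, the first smaller one (\<open>descendants_brt_tree\<close>).
  Hence an entry has at least \<open>k\<close> descendants if and only if the next \<open>k\<close> entries exist and are all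
  larger.  The root qualifies since \<open>k \<le> n - 1\<close>, and the number of nodes in question is one plus the number
  of positions of \<open>\<gamma>\<close> that are followed by \<open>k\<close> larger entries (\<open>num_ge_descendants_brt_tree\<close>).

  The shuffle is then described by a random word: let each position carry the number of the pile
  from which its card comes.  Given the pile sizes \<open>b\<close>, the interleavings correspond bijectively to
  the words of content \<open>b\<close> (\<open>bij_betw_shuffle_of_word\<close>), the arrangement being recovered by
  ranking the positions stably according to their letters.  There are \<open>(n - 1)! / \<Prod>\<^sub>s (b s)!\<close> such words,
  which cancels the multinomial coefficient, so that the letters are independent with
  distribution \<open>p\<close> (\<open>riffle_shuffle_pmf_eq_map_words\<close>).  An earlier position holds a smaller card than
  a later one exactly if its letter is at most the later letter.

  Thus each of the \<open>n - 1 - k\<close> positions having \<open>k\<close> successors is counted with probability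
  \<open>\<Sum>\<^sub>s p\<^sub>s (\<Sum>\<^sub>r\<^sub>\<ge>\<^sub>s p\<^sub>r)\<^sup>k\<close>, by conditioning on its letter \<open>s\<close> (\<open>expectation_card_run_starts\<close>).  In the
  uniform case the sum is \<open>a\<^sup>-\<^sup>(\<^sup>k\<^sup>+\<^sup>1\<^sup>) \<Sum>\<^sub>s s\<^sup>k\<close> after reversing the alphabet, and it tends to \<open>1 / (k + 1)\<close>.
\<close>

section \<open>Descendants in the tree of an arrangement\<close>

text \<open>The positions of a list whose entry is related by \<open>R\<close> to each of the next \<open>k\<close> entries; these are
  required to exist.\<close>

definition run_starts :: "('a \<Rightarrow> 'a \<Rightarrow> bool) \<Rightarrow> nat \<Rightarrow> 'a list \<Rightarrow> nat set" where
  "run_starts R k xs = {t. t + k < length xs \<and> (\<forall>j\<in>{1..k}. R (xs ! t) (xs ! (t + j)))}"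

lemma finite_run_starts [simp]: "finite (run_starts R k xs)"
  by (rule finite_subset[of _ "{..<length xs}"]) (auto simp: run_starts_def)

lemma card_run_starts_Cons:
  "card (run_starts R k (x # xs))
     = of_bool (k \<le> length xs \<and> (\<forall>y\<in>set (take k xs). R x y)) + card (run_starts R k xs)"
proof -
  let ?c = "k \<le> length xs \<and> (\<forall>y\<in>set (take k xs). R x y)"
  have c: "0 \<in> run_starts R k (x # xs) \<longleftrightarrow> ?c"
  proof -
    have "(\<forall>j\<in>{1..k}. R x ((x # xs) ! j)) \<longleftrightarrow> (\<forall>i<k. R x (xs ! i))"
      unfolding image_Suc_lessThan[symmetric] by auto
    moreover have "(\<forall>y\<in>set (take k xs). R x y) \<longleftrightarrow> (\<forall>i<k. R x (xs ! i))" if "k \<le> length xs"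
      using that by (simp add: all_set_conv_all_nth min_absorb2)
    ultimately show ?thesis
      by (auto simp: run_starts_def)
  qed
  have s: "Suc t \<in> run_starts R k (x # xs) \<longleftrightarrow> t \<in> run_starts R k xs" for t
    by (simp add: run_starts_def)
  have "run_starts R k (x # xs) = (if ?c then {0} else {}) \<union> Suc ` run_starts R k xs"
  proof (rule set_eqI)
    show "t \<in> run_starts R k (x # xs) \<longleftrightarrow> t \<in> (if ?c then {0} else {}) \<union> Suc ` run_starts R k xs" for t
      using c s by (cases t) auto
  qed
  also have "card \<dots> = card (if ?c then {0::nat} else {}) + card (Suc ` run_starts R k xs)"
    by (rule card_Un_disjoint) auto
  finally show ?thesis
    by (simp add: card_image)
qed

lemma last_filter_position:
  assumes "filter P xs \<noteq> []"
  shows "\<exists>u<length xs. last (filter P xs) = xs ! u \<and> P (xs ! u) \<and>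
           (\<forall>x. u < x \<and> x < length xs \<longrightarrow> \<not> P (xs ! x))"
  using assms
proof (induction xs rule: rev_induct)
  case (snoc x xs)
  show ?case
  proof (cases "P x")
    case True
    then show ?thesis by (intro exI[of _ "length xs"]) auto
  next
    case False
    then obtain u where "u < length xs" "last (filter P xs) = xs ! u" "P (xs ! u)"
      "\<forall>x. u < x \<and> x < length xs \<longrightarrow> \<not> P (xs ! x)"
      using snoc by auto
    then show ?thesis
      using False by (intro exI[of _ u]) (auto simp: nth_append less_Suc_eq)
  qed
qed simp

lemma arrangement_Cons_root:
  assumes "\<gamma> \<in> permutations_of_set {2..n}" "n \<ge> 1"
  shows "distinct (1 # \<gamma>)" "set (1 # \<gamma>) = {1..n}" "length (1 # \<gamma>) = n"
proof -
  show d: "distinct (1 # \<gamma>)" and s: "set (1 # \<gamma>) = {1..n}"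
    using assms by (auto simp: permutations_of_set_def)
  show "length (1 # \<gamma>) = n"
    using distinct_card[OF d] unfolding s by simp
qed

text \<open>With the root in front, the default parent \<open>1\<close> needs no separate treatment: if no earlier card is
  smaller, the nearest smaller entry to the left is the root at position \<open>0\<close>.\<close>

lemma brt_parent_position:
  assumes \<gamma>: "\<gamma> \<in> permutations_of_set {2..n}" and "n \<ge> 1" and t: "0 < t" "t < n"
  defines "\<delta> \<equiv> 1 # \<gamma>"
  shows "\<exists>u<t. brt_parent \<gamma> (\<delta> ! t) = \<delta> ! u \<and> \<delta> ! u < \<delta> ! t \<and> (\<forall>x\<in>{u<..<t}. \<delta> ! t < \<delta> ! x)"
proof -
  note \<delta> = arrangement_Cons_root[OF \<gamma> \<open>n \<ge> 1\<close>, folded \<delta>_def]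
  let ?i = "\<delta> ! t"
  have i: "?i = \<gamma> ! (t - 1)" "t - 1 < length \<gamma>"
    using t \<delta>(3) by (auto simp: \<delta>_def nth_Cons')
  have "?i \<in> {2..n}"
    using i \<gamma> by (metis nth_mem permutations_of_setD(1))
  then have "1 < ?i" by simp
  have "takeWhile (\<lambda>j. j \<noteq> ?i) \<gamma> = take (t - 1) \<gamma>"
    using i \<delta>(1) by (intro takeWhile_eq_take_P_nth) (auto simp: \<delta>_def nth_eq_iff_index_eq)
  moreover have tk: "take t \<delta> = 1 # take (t - 1) \<gamma>"
    using t by (simp add: \<delta>_def take_Cons')
  ultimately have par: "brt_parent \<gamma> ?i = last (filter (\<lambda>j. j < ?i) (take t \<delta>))"
    using \<open>1 < ?i\<close> by (simp add: brt_parent_def Let_def)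
  have ne: "filter (\<lambda>j. j < ?i) (take t \<delta>) \<noteq> []"
    using tk \<open>1 < ?i\<close> by simp
  have len: "length (take t \<delta>) = t"
    using \<delta>(3) t by simp
  obtain u where u: "u < t" "brt_parent \<gamma> ?i = \<delta> ! u" "\<delta> ! u < ?i"
    "\<And>x. u < x \<Longrightarrow> x < t \<Longrightarrow> \<not> \<delta> ! x < ?i"
    using last_filter_position[OF ne] unfolding len par by auto
  have "?i < \<delta> ! x" if "u < x" "x < t" for x
  proof -
    have "\<delta> ! x \<noteq> ?i"
      using that t \<delta> by (subst nth_eq_iff_index_eq) auto
    then show ?thesis
      using u(4)[OF that] by simp
  qed
  then show ?thesis
    using u by auto
qed

lemma descendants_brt_tree:
  assumes \<gamma>: "\<gamma> \<in> permutations_of_set {2..n}" and "n \<ge> 1" and t: "t < n"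
  defines "\<delta> \<equiv> 1 # \<gamma>"
  shows "descendants (brt_tree n \<gamma>) (\<delta> ! t)
           = (!) \<delta> ` {t'. t < t' \<and> t' < n \<and> (\<forall>x\<in>{t<..t'}. \<delta> ! t < \<delta> ! x)}"
    (is "_ = _ ` ?D t")
proof -
  note \<delta> = arrangement_Cons_root[OF \<gamma> \<open>n \<ge> 1\<close>, folded \<delta>_def]
  note parent = brt_parent_position[OF \<gamma> \<open>n \<ge> 1\<close>, folded \<delta>_def]
  let ?T = "brt_tree n \<gamma>"
  have inj: "\<delta> ! u = \<delta> ! u' \<longleftrightarrow> u = u'" if "u < n" "u' < n" for u u'
    using that \<delta> by (simp add: nth_eq_iff_index_eq)
  have ge2: "\<delta> ! u \<in> {2..n}" if "0 < u" "u < n" for u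
  proof -
    have "\<delta> ! u \<in> set \<delta>" "\<delta> ! u \<noteq> \<delta> ! 0"
      using that \<delta>(3) inj[of u 0] by auto
    then show ?thesis
      unfolding \<delta>(2) by (auto simp: \<delta>_def)
  qed
  have edge: "(v, w) \<in> ?T \<longleftrightarrow> w \<in> {2..n} \<and> v = brt_parent \<gamma> w" for v w
    by (auto simp: brt_tree_def)
  have child: "\<exists>u u'. u < u' \<and> u' < n \<and> v = \<delta> ! u \<and> w = \<delta> ! u' \<and> \<delta> ! u < \<delta> ! u' \<and>
                 (\<forall>x\<in>{u<..<u'}. \<delta> ! u' < \<delta> ! x)" if "(v, w) \<in> ?T" for v w
  proof -
    have "w \<in> set \<delta>" "w \<noteq> 1"
      using that unfolding \<delta>(2) edge by auto
    then obtain u' where u': "u' < n" "w = \<delta> ! u'"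
      using \<delta>(3) by (auto simp: in_set_conv_nth)
    have "0 < u'"
      using u' \<open>w \<noteq> 1\<close> by (cases u') (auto simp: \<delta>_def)
    from parent[OF this u'(1)] that u' show ?thesis
      unfolding edge by blast
  qed
  have "descendants ?T (\<delta> ! t) \<subseteq> (!) \<delta> ` ?D t"
  proof
    fix w assume "w \<in> descendants ?T (\<delta> ! t)"
    then have "(\<delta> ! t, w) \<in> ?T\<^sup>+" by (simp add: descendants_def)
    then show "w \<in> (!) \<delta> ` ?D t"
    proof (induction rule: trancl_induct)
      case (base y)
      then obtain u u' where u: "u < u'" "u' < n" "\<delta> ! t = \<delta> ! u" "y = \<delta> ! u'" "\<delta> ! u < \<delta> ! u'"
        "\<forall>x\<in>{u<..<u'}. \<delta> ! u' < \<delta> ! x"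
        using child by blast
      have "u = t" using inj[of t u] u(1-3) t by simp
      have "\<delta> ! t < \<delta> ! x" if "x \<in> {t<..u'}" for x
      proof (cases "x = u'")
        case False
        then have "\<delta> ! u' < \<delta> ! x" using that u(6) \<open>u = t\<close> by auto
        then show ?thesis using u by simp
      qed (use u in simp)
      then show ?case using u \<open>u = t\<close> by blast
    next
      case (step y z)
      then obtain s where s: "s \<in> ?D t" "y = \<delta> ! s" by blast
      from step(2) obtain u u' where u: "u < u'" "u' < n" "y = \<delta> ! u" "z = \<delta> ! u'" "\<delta> ! u < \<delta> ! u'"
        "\<forall>x\<in>{u<..<u'}. \<delta> ! u' < \<delta> ! x"
        using child by blast
      have "s < n" "t < s" using s(1) by auto
      have "u = s" using inj[of s u] u(1-3) s(2) \<open>s < n\<close> by simp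
      have "\<delta> ! t < \<delta> ! s" using s by auto
      have "\<delta> ! t < \<delta> ! x" if "x \<in> {t<..u'}" for x
      proof -
        consider "x \<le> s" | "s < x" "x < u'" | "x = u'"
          using \<open>x \<in> {t<..u'}\<close> by fastforce
        then show ?thesis
        proof cases
          case 1
          then show ?thesis using that s by auto
        next
          case 2
          then have "\<delta> ! u' < \<delta> ! x" using u(6) \<open>u = s\<close> by auto
          then show ?thesis using u(5) \<open>\<delta> ! t < \<delta> ! s\<close> \<open>u = s\<close> by simp
        next
          case 3
          then show ?thesis using u(5) \<open>\<delta> ! t < \<delta> ! s\<close> \<open>u = s\<close> by simp
        qed
      qed
      then have "u' \<in> ?D t" using u(1,2) \<open>t < s\<close> \<open>u = s\<close> by simp
      then show ?case using u(4) by blast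
    qed
  qed
  moreover have "(\<delta> ! t, \<delta> ! t') \<in> ?T\<^sup>+" if "t' \<in> ?D t" for t'
    using that
  proof (induction t' rule: less_induct)
    case (less t')
    then have t': "t < t'" "t' < n" "\<And>x. t < x \<Longrightarrow> x \<le> t' \<Longrightarrow> \<delta> ! t < \<delta> ! x"
      by auto
    then obtain u where u: "u < t'" "brt_parent \<gamma> (\<delta> ! t') = \<delta> ! u" "\<forall>x\<in>{u<..<t'}. \<delta> ! t' < \<delta> ! x"
      using parent[of t'] by auto
    have e: "(\<delta> ! u, \<delta> ! t') \<in> ?T"
      unfolding edge using u(2) t' ge2[of t'] by simp
    \<comment> \<open>the parent of \<open>\<delta> ! t'\<close> cannot lie to the left of \<open>\<delta> ! t\<close>, which is smaller than \<open>\<delta> ! t'\<close>\<close>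
    have "t \<le> u"
    proof (rule ccontr)
      assume "\<not> t \<le> u"
      then have "\<delta> ! t' < \<delta> ! t" using u(3) t'(1) by simp
      then show False using t'(1) t'(3)[of t'] by simp
    qed
    show ?case
    proof (cases "u = t")
      case True
      then show ?thesis using e by blast
    next
      case False
      then have "t < u" using \<open>t \<le> u\<close> by simp
      then have "u \<in> ?D t" using u(1) t' by simp
      then show ?thesis using less.IH[OF u(1)] e by (blast intro: trancl_into_trancl)
    qed
  qed
  ultimately show ?thesis
    by (auto simp: descendants_def)
qed

lemma card_descendants_ge_iff:
  assumes \<gamma>: "\<gamma> \<in> permutations_of_set {2..n}" and "n \<ge> 1" and t: "t < n"
  shows "k \<le> card (descendants (brt_tree n \<gamma>) ((1 # \<gamma>) ! t)) \<longleftrightarrow> t \<in> run_starts (<) k (1 # \<gamma>)"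
proof -
  define \<delta> where "\<delta> = 1 # \<gamma>"
  note \<delta> = arrangement_Cons_root[OF \<gamma> \<open>n \<ge> 1\<close>, folded \<delta>_def]
  define D where "D = {t'. t < t' \<and> t' < n \<and> (\<forall>x\<in>{t<..t'}. \<delta> ! t < \<delta> ! x)}"
  have "inj_on ((!) \<delta>) D"
    using \<delta> by (auto simp: D_def inj_on_def nth_eq_iff_index_eq)
  then have card: "card (descendants (brt_tree n \<gamma>) (\<delta> ! t)) = card D"
    using descendants_brt_tree[OF assms] by (simp only: D_def \<delta>_def card_image)
  have fin: "finite D"
    by (rule finite_subset[of _ "{..<n}"]) (auto simp: D_def)
  have "k \<le> card D \<longleftrightarrow> t \<in> run_starts (<) k \<delta>"
  proof
    assume "t \<in> run_starts (<) k \<delta>"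
    then have r: "t + k < n" "\<And>j. 1 \<le> j \<Longrightarrow> j \<le> k \<Longrightarrow> \<delta> ! t < \<delta> ! (t + j)"
      using \<delta> by (auto simp: run_starts_def)
    have "\<delta> ! t < \<delta> ! x" if "t < x" "x \<le> t + k" for x
      using r(2)[of "x - t"] that by simp
    then have "{t<..t + k} \<subseteq> D"
      using r(1) by (auto simp: D_def)
    from card_mono[OF fin this] show "k \<le> card D" by simp
  next
    assume k: "k \<le> card D"
    show "t \<in> run_starts (<) k \<delta>"
    proof (cases "k = 0")
      case True
      then show ?thesis using t \<delta> by (simp add: run_starts_def)
    next
      case False
      \<comment> \<open>\<open>D\<close> is an interval starting at \<open>t + 1\<close>, so it suffices to find one far element\<close>
      have "\<exists>t'\<in>D. t + k \<le> t'"
      proof (rule ccontr)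
        assume "\<not> ?thesis"
        then have "D \<subseteq> {t<..<t + k}" by (auto simp: D_def)
        from card_mono[OF _ this] show False using k False by simp
      qed
      then show ?thesis
        using \<delta> by (auto simp: D_def run_starts_def)
    qed
  qed
  then show ?thesis
    using card by (simp add: \<delta>_def)
qed

lemma num_ge_descendants_brt_tree:
  assumes \<gamma>: "\<gamma> \<in> permutations_of_set {2..n}" and "n \<ge> 1" "k \<le> n - 1"
  shows "num_ge_descendants k n (brt_tree n \<gamma>) = 1 + card (run_starts (<) k \<gamma>)"
proof -
  define \<delta> where "\<delta> = 1 # \<gamma>"
  note \<delta> = arrangement_Cons_root[OF \<gamma> \<open>n \<ge> 1\<close>, folded \<delta>_def]
  have sub: "run_starts (<) k \<delta> \<subseteq> {..<n}"
    using \<delta> by (auto simp: run_starts_def)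
  have iff: "k \<le> card (descendants (brt_tree n \<gamma>) (\<delta> ! t)) \<longleftrightarrow> t \<in> run_starts (<) k \<delta>"
    if "t < n" for t
    using card_descendants_ge_iff[OF assms(1,2) that] by (simp add: \<delta>_def)
  have "{1..n} = (!) \<delta> ` {..<n}"
    using \<delta> by (auto simp: set_conv_nth)
  then have "{v \<in> {1..n}. k \<le> card (descendants (brt_tree n \<gamma>) v)}
      = (!) \<delta> ` {t \<in> {..<n}. k \<le> card (descendants (brt_tree n \<gamma>) (\<delta> ! t))}"
    by (simp only: Compr_image_eq)
  also have "{t \<in> {..<n}. k \<le> card (descendants (brt_tree n \<gamma>) (\<delta> ! t))} = run_starts (<) k \<delta>"
    using sub by (auto simp: iff)
  finally have "{v \<in> {1..n}. k \<le> card (descendants (brt_tree n \<gamma>) v)} = (!) \<delta> ` run_starts (<) k \<delta>" .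
  moreover have "inj_on ((!) \<delta>) (run_starts (<) k \<delta>)"
    using sub \<delta>(1,3) by (intro inj_on_nth) auto
  ultimately have "num_ge_descendants k n (brt_tree n \<gamma>) = card (run_starts (<) k \<delta>)"
    by (simp add: num_ge_descendants_def card_image)
  moreover have "k \<le> length \<gamma>"
    using assms(3) \<delta>(3) by (simp add: \<delta>_def)
  moreover have "1 < y" if "y \<in> set (take k \<gamma>)" for y
    using in_set_takeD[OF that] permutations_of_setD(1)[OF \<gamma>] by simp
  ultimately show ?thesis
    by (simp add: \<delta>_def card_run_starts_Cons)
qed

section \<open>Interleavings of piles and words\<close>

text \<open>The order on the positions of a word obtained by sorting its letters stably: smaller letters come
  first, and equal letters keep their order.\<close>

definition precedes :: "nat list \<Rightarrow> nat \<Rightarrow> nat \<Rightarrow> bool" where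
  "precedes w u t \<longleftrightarrow> w ! u < w ! t \<or> w ! u = w ! t \<and> u < t"

text \<open>The number of positions before \<open>t\<close> in this order.\<close>

definition stable_rank :: "nat list \<Rightarrow> nat \<Rightarrow> nat" where
  "stable_rank w t = card {u. u < length w \<and> precedes w u t}"

text \<open>The arrangement of the deck \<open>2, \<dots>, length w + 1\<close> in which the card at each position comes from the
  pile named by the letter of \<open>w\<close> there; up to the shift by \<open>2\<close>
  it is the inverse of the permutation sorting \<open>w\<close> stably.\<close>

definition shuffle_of_word :: "nat list \<Rightarrow> nat list" where
  "shuffle_of_word w = map (\<lambda>t. 2 + stable_rank w t) [0..<length w]"

text \<open>The words in which each letter \<open>s\<close> occurs exactly \<open>b s\<close> times.\<close>

definition words :: "('s \<Rightarrow> nat) \<Rightarrow> 's list set" where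
  "words b = {w. count (mset w) = b}"

lemma precedes_irrefl: "\<not> precedes w t t"
  and precedes_trans: "precedes w u t \<Longrightarrow> precedes w t x \<Longrightarrow> precedes w u x"
  and precedes_total: "u \<noteq> t \<Longrightarrow> precedes w u t \<or> precedes w t u"
  by (auto simp: precedes_def)

lemma length_shuffle_of_word [simp]: "length (shuffle_of_word w) = length w"
  by (simp add: shuffle_of_word_def)

lemma nth_shuffle_of_word [simp]: "t < length w \<Longrightarrow> shuffle_of_word w ! t = 2 + stable_rank w t"
  by (simp add: shuffle_of_word_def)

lemma card_less_if_missing:
  assumes "finite B" "A \<subseteq> B" "x \<in> B" "x \<notin> A"
  shows "card A < card B"
  using assms by (intro psubset_card_mono) auto

lemma stable_rank_less_iff:
  assumes "u < length w" "t < length w"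
  shows "stable_rank w u < stable_rank w t \<longleftrightarrow> precedes w u t"
proof -
  have mono: "stable_rank w u < stable_rank w t" if "precedes w u t" "u < length w" for u t
    unfolding stable_rank_def
    by (rule card_less_if_missing[where x = u])
      (use that precedes_trans[OF _ that(1)] precedes_irrefl[of w u] in auto)
  show ?thesis
    using mono[of u t] mono[of t u] precedes_total[of u t w] assms less_irrefl less_asym by metis
qed

lemma stable_rank_inject:
  assumes "u < length w" "t < length w"
  shows "stable_rank w u = stable_rank w t \<longleftrightarrow> u = t"
  using assms stable_rank_less_iff precedes_total by (metis less_irrefl)

lemma stable_rank_less_length:
  assumes "t < length w"
  shows "stable_rank w t < length w"
proof -
  have "stable_rank w t < card {..<length w}"
    unfolding stable_rank_def
    by (rule card_less_if_missing[where x = t]) (use assms precedes_irrefl[of w t] in auto)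
  then show ?thesis by simp
qed

lemma shuffle_of_word_in_permutations:
  "shuffle_of_word w \<in> permutations_of_set {2..length w + 1}"
proof -
  have d: "distinct (shuffle_of_word w)"
    by (simp add: distinct_conv_nth stable_rank_inject)
  have "set (shuffle_of_word w) \<subseteq> {2..length w + 1}"
    using stable_rank_less_length by (fastforce simp: shuffle_of_word_def)
  moreover have "card (set (shuffle_of_word w)) = card {2..length w + 1}"
    using distinct_card[OF d] by simp
  ultimately have "set (shuffle_of_word w) = {2..length w + 1}"
    by (intro card_subset_eq) auto
  with d show ?thesis
    by (intro permutations_of_setI)
qed

text \<open>A strict comparison of cards becomes a weak comparison of letters, since of two equal letters the
  earlier one receives the smaller card.\<close>

lemma run_starts_shuffle_of_word:
  "run_starts (<) k (shuffle_of_word w) = run_starts (\<le>) k w"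
proof -
  have "precedes w t (t + j) \<longleftrightarrow> w ! t \<le> w ! (t + j)" if "j \<ge> 1" for t j
    using that by (auto simp: precedes_def)
  then show ?thesis
    by (auto simp: run_starts_def stable_rank_less_iff)
qed

lemma words_compositions:
  assumes "w \<in> words b" "b \<in> compositions S m" "finite S"
  shows "set w \<subseteq> S" "length w = m"
proof -
  show s: "set w \<subseteq> S"
  proof
    fix x assume "x \<in> set w"
    then have "b x \<noteq> 0" using assms(1) by (auto simp: words_def)
    then show "x \<in> S" using assms(2) by (auto simp: compositions_def)
  qed
  have "length w = (\<Sum>x\<in>set w. b x)"
    using assms(1) by (auto simp: words_def size_multiset_overloaded_eq simp flip: size_mset)
  also have "\<dots> = (\<Sum>x\<in>S. b x)"
    using assms s by (intro sum.mono_neutral_left) (auto simp: words_def)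
  finally show "length w = m"
    using assms(2) by (simp add: compositions_def)
qed

lemma card_letters_less:
  fixes w :: "nat list"
  assumes "set w \<subseteq> {1..a}"
  shows "card {u. u < length w \<and> w ! u < s} = (\<Sum>r=1..<s. count (mset w) r)"
proof -
  have "length (filter (\<lambda>x. x < s) w) = (\<Sum>r=1..<s. count (mset w) r)"
    using assms
  proof (induction w)
    case (Cons x w)
    have "(\<Sum>r=1..<s. count (mset (x # w)) r)
        = (\<Sum>r=1..<s. (if r = x then 1 else 0) + count (mset w) r)"
      by (intro sum.cong) auto
    also have "\<dots> = (if x \<in> {1..<s} then 1 else 0) + (\<Sum>r=1..<s. count (mset w) r)"
      by (simp add: sum.distrib)
    finally show ?case using Cons by auto
  qed simp
  then show ?thesis
    by (simp add: length_filter_conv_card)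
qed

lemma set_pile: "set (pile b s) = {2 + (\<Sum>r=1..<s. b r)..<2 + (\<Sum>r=1..s. b r)}"
  by (simp only: pile_def set_upt)

lemma sorted_pile: "sorted_wrt (<) (pile b s)"
  by (simp only: pile_def sorted_wrt_upt)

lemma card_set_pile: "card (set (pile b s)) = length (pile b s)"
  using sorted_pile[of b s] by (simp add: strict_sorted_iff distinct_card)

text \<open>All positions with letters below \<open>w ! t\<close> are ranked before \<open>t\<close>, and only positions with letters up to
  \<open>w ! t\<close> are.\<close>

lemma shuffle_of_word_in_pile:
  assumes "set w \<subseteq> {1..a}" "count (mset w) = b" "t < length w"
  shows "shuffle_of_word w ! t \<in> set (pile b (w ! t))"
proof -
  let ?s = "w ! t"
  have "?s \<ge> 1" using assms by (meson atLeastAtMost_iff nth_mem subsetD)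
  have "{u. u < length w \<and> w ! u < ?s} \<subseteq> {u. u < length w \<and> precedes w u t}"
    by (auto simp: precedes_def)
  then have "card {u. u < length w \<and> w ! u < ?s} \<le> stable_rank w t"
    unfolding stable_rank_def by (intro card_mono) simp_all
  then have "(\<Sum>r=1..<?s. b r) \<le> stable_rank w t"
    unfolding card_letters_less[OF assms(1)] assms(2) .
  moreover have "stable_rank w t < card {u. u < length w \<and> w ! u < Suc ?s}"
    unfolding stable_rank_def
    by (rule card_less_if_missing[where x = t]) (use assms(3) in \<open>auto simp: precedes_def\<close>)
  then have "stable_rank w t < (\<Sum>r=1..?s. b r)"
    unfolding card_letters_less[OF assms(1)] assms(2) atLeastLessThanSuc_atLeastAtMost .
  ultimately show ?thesis
    using assms(3) by (simp add: set_pile)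
qed

lemma pile_less:
  assumes "c \<in> set (pile b s)" "c' \<in> set (pile b s')" "s < s'"
  shows "c < c'"
proof -
  have "(\<Sum>r=1..s. b r) \<le> (\<Sum>r=1..<s'. b r)"
    using assms(3) by (intro sum_mono2) auto
  then show ?thesis
    using assms by (auto simp: set_pile)
qed

lemma pile_unique:
  assumes "c \<in> set (pile b s)" "c \<in> set (pile b s')"
  shows "s = s'"
  using pile_less[OF assms] pile_less[OF assms(2,1)] by (cases s s' rule: linorder_cases) auto

lemma length_pile:
  assumes "s \<ge> 1"
  shows "length (pile b s) = b s"
proof -
  have "{1..s} = insert s {1..<s}" using assms by auto
  then have "(\<Sum>r=1..s. b r) = b s + (\<Sum>r=1..<s. b r)" by simp
  then show ?thesis by (simp only: pile_def length_upt)
qed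

lemma pile_exists:
  assumes "b \<in> compositions {1..a} m" "c \<in> {2..m + 1}"
  shows "\<exists>s\<in>{1..a}. c \<in> set (pile b s)"
proof -
  have "c < 2 + (\<Sum>r=1..a. b r)"
    using assms by (simp add: compositions_def)
  then show ?thesis
  proof (induction a)
    case 0
    then show ?case using assms(2) by simp
  next
    case (Suc a)
    show ?case
    proof (cases "c < 2 + (\<Sum>r=1..a. b r)")
      case True
      then show ?thesis using Suc.IH by auto
    next
      case False
      then have "c \<in> set (pile b (Suc a))"
        using Suc.prems by (simp add: set_pile atLeastLessThanSuc_atLeastAtMost)
      then show ?thesis by auto
    qed
  qed
qed

lemma subseq_distinct_sorted:
  assumes "subseq xs ys" "sorted xs" "distinct ys"
  shows "sorted_wrt (\<lambda>x y. x \<in> set xs \<and> y \<in> set xs \<longrightarrow> x \<le> y) ys"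
  using assms
proof (induction rule: list_emb.induct)
  case (list_emb_Cons xs ys y)
  have "set xs \<subseteq> set ys"
    using list_emb_Cons(1) by (rule list_emb_set[THEN subsetI]) auto
  then show ?case using list_emb_Cons by auto
next
  case (list_emb_Cons2 x y xs ys)
  have "sorted_wrt (\<lambda>x y. x \<in> set xs \<and> y \<in> set xs \<longrightarrow> x \<le> y) ys"
    using list_emb_Cons2 by simp
  then have "sorted_wrt (\<lambda>u v. u \<in> set (x # xs) \<and> v \<in> set (x # xs) \<longrightarrow> u \<le> v) ys"
    by (rule sorted_wrt_mono_rel[rotated]) (use list_emb_Cons2 in auto)
  then show ?case using list_emb_Cons2 by auto
qed (induction ys, auto)

lemma subseq_pile_shuffle_of_word:
  assumes "set w \<subseteq> {1..a}" "count (mset w) = b" "s \<ge> 1"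
  shows "subseq (pile b s) (shuffle_of_word w)"
proof -
  define L where "L = map (\<lambda>t. 2 + stable_rank w t) (filter (\<lambda>t. w ! t = s) [0..<length w])"
  have sL: "subseq L (shuffle_of_word w)"
    unfolding L_def shuffle_of_word_def by (intro subseq_map subseq_filter_left)
  have "sorted_wrt (<) (filter (\<lambda>t. w ! t = s) [0..<length w])"
    by (intro sorted_wrt_filter) simp
  then have str: "sorted_wrt (<) L"
    unfolding L_def sorted_wrt_map
    by (rule sorted_wrt_mono_rel[rotated]) (auto simp: stable_rank_less_iff precedes_def)
  have "length L = b s"
  proof -
    have "length L = card {t. t < length w \<and> w ! t = s}"
      unfolding L_def length_map length_filter_conv_card by (intro arg_cong[of _ _ card]) auto
    also have "\<dots> = count (mset w) s"
      by (simp add: count_mset count_list_eq_length_filter length_filter_conv_card eq_commute)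
    finally show ?thesis using assms(2) by simp
  qed
  then have "card (set L) = card (set (pile b s))"
    using str length_pile[OF assms(3), of b]
    by (simp add: distinct_card strict_sorted_iff card_set_pile)
  moreover have "set L \<subseteq> set (pile b s)"
    using shuffle_of_word_in_pile[OF assms(1,2)] by (auto simp: L_def)
  ultimately have "set L = set (pile b s)"
    by (intro card_subset_eq) auto
  then have "L = pile b s"
    using str sorted_pile by (intro strict_sorted_equal) auto
  then show ?thesis using sL by simp
qed

lemma inj_on_shuffle_of_word:
  assumes b: "b \<in> compositions {1..a} m"
  shows "inj_on shuffle_of_word (words b)"
proof (rule inj_onI)
  fix v w assume vw: "v \<in> words b" "w \<in> words b" and eq: "shuffle_of_word v = shuffle_of_word w"
  note v = words_compositions[OF vw(1) b finite_atLeastAtMost]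
  note w = words_compositions[OF vw(2) b finite_atLeastAtMost]
  show "v = w"
  proof (rule nth_equalityI)
    show "length v = length w" using v w by simp
    fix t assume t: "t < length v"
    then have "shuffle_of_word v ! t \<in> set (pile b (v ! t))"
      using vw v by (intro shuffle_of_word_in_pile) (auto simp: words_def)
    moreover have "shuffle_of_word w ! t \<in> set (pile b (w ! t))"
      using vw w t v by (intro shuffle_of_word_in_pile) (auto simp: words_def)
    ultimately show "v ! t = w ! t"
      unfolding eq by (rule pile_unique)
  qed
qed

lemma shuffle_of_word_surj:
  assumes b: "b \<in> compositions {1..a} (n - 1)" and "n \<ge> 1" and \<gamma>: "\<gamma> \<in> interleavings n a b"
  shows "\<gamma> \<in> shuffle_of_word ` words b"
proof -
  have d: "distinct \<gamma>" and set\<gamma>: "set \<gamma> = {2..n}"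
    and sub: "\<And>s. s \<in> {1..a} \<Longrightarrow> subseq (pile b s) \<gamma>"
    using \<gamma> by (auto simp: interleavings_def permutations_of_set_def)
  have "\<exists>s. s \<in> {1..a} \<and> c \<in> set (pile b s)" if "c \<in> {2..n}" for c
    using pile_exists[OF b, of c] that \<open>n \<ge> 1\<close> by auto
  then obtain idx where idx: "\<And>c. c \<in> {2..n} \<Longrightarrow> idx c \<in> {1..a} \<and> c \<in> set (pile b (idx c))"
    by metis
  \<comment> \<open>the preimage records the pile from which each card comes\<close>
  define w where "w = map idx \<gamma>"
  have lenw: "length w = length \<gamma>" by (simp add: w_def)
  have pile_sub: "set (pile b s) \<subseteq> {2..n}" if "s \<in> {1..a}" for s
    using list_emb_set[OF sub[OF that]] set\<gamma> by blast
  have "count (mset w) s = b s" for s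
  proof (cases "s \<in> {1..a}")
    case True
    have "count (mset w) s = length (filter (\<lambda>c. idx c = s) \<gamma>)"
      unfolding count_mset count_list_eq_length_filter by (simp add: w_def filter_map o_def eq_commute)
    also have "\<dots> = card {c \<in> {2..n}. idx c = s}"
      using distinct_card[OF distinct_filter[OF d]] set\<gamma> by simp
    also have "{c \<in> {2..n}. idx c = s} = set (pile b s)"
    proof (intro equalityI subsetI)
      fix c assume c: "c \<in> set (pile b s)"
      then have "c \<in> {2..n}" using pile_sub[OF True] by blast
      then show "c \<in> {c \<in> {2..n}. idx c = s}" using idx[of c] pile_unique[OF c] by auto
    qed (use idx in auto)
    also have "card \<dots> = b s"
      using length_pile[of s b] True by (simp add: card_set_pile)
    finally show ?thesis .
  next
    case False
    have "s \<notin> set w"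
      using False idx set\<gamma> by (auto simp: w_def)
    then have "count (mset w) s = 0" by simp
    then show ?thesis
      using b False by (simp add: compositions_def)
  qed
  then have "w \<in> words b" by (simp add: words_def fun_eq_iff)
  have in_pile: "\<gamma> ! t \<in> set (pile b (w ! t))" "w ! t \<in> {1..a}" if "t < length \<gamma>" for t
  proof -
    have "\<gamma> ! t \<in> {2..n}" using nth_mem[OF that] set\<gamma> by blast
    then show "\<gamma> ! t \<in> set (pile b (w ! t))" "w ! t \<in> {1..a}"
      using idx that by (simp_all only: w_def nth_map)
  qed
  \<comment> \<open>for equal letters this is the increasing order of the cards of one pile in \<open>\<gamma>\<close>\<close>
  have prec: "\<gamma> ! u < \<gamma> ! t" if "precedes w u t" "u < length \<gamma>" "t < length \<gamma>" for u t
  proof -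
    consider "w ! u < w ! t" | "w ! u = w ! t" "u < t"
      using \<open>precedes w u t\<close> by (auto simp: precedes_def)
    then show ?thesis
    proof cases
      case 1
      then show ?thesis by (rule pile_less[OF in_pile(1)[OF that(2)] in_pile(1)[OF that(3)]])
    next
      case 2
      have "sorted_wrt (\<lambda>x y. x \<in> set (pile b (w ! t)) \<and> y \<in> set (pile b (w ! t)) \<longrightarrow> x \<le> y) \<gamma>"
        by (rule subseq_distinct_sorted[OF sub[OF in_pile(2)[OF that(3)]] _ d])
          (rule strict_sorted_imp_sorted[OF sorted_pile])
      then have "\<gamma> ! u \<le> \<gamma> ! t"
        using in_pile(1)[OF that(2)] in_pile(1)[OF that(3)] 2 that(3)
        unfolding sorted_wrt_iff_nth_less by metis
      moreover have "\<gamma> ! u \<noteq> \<gamma> ! t"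
        using d 2 that by (simp add: nth_eq_iff_index_eq)
      ultimately show ?thesis by simp
    qed
  qed
  have iff: "precedes w u t \<longleftrightarrow> \<gamma> ! u < \<gamma> ! t" if "u < length \<gamma>" "t < length \<gamma>" for u t
    using prec[OF _ that] prec[OF _ that(2,1)] precedes_total[of u t w] precedes_irrefl[of w t]
    by (metis less_asym)
  have "shuffle_of_word w = \<gamma>"
  proof (rule nth_equalityI)
    show "length (shuffle_of_word w) = length \<gamma>" by (simp add: lenw)
    fix t assume "t < length (shuffle_of_word w)"
    then have t: "t < length \<gamma>" by (simp add: lenw)
    have t2: "\<gamma> ! t \<in> {2..n}" using nth_mem[OF t] set\<gamma> by blast
    let ?U = "{u. u < length \<gamma> \<and> \<gamma> ! u < \<gamma> ! t}"
    have "{u. u < length w \<and> precedes w u t} = ?U"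
      using iff[OF _ t] by (auto simp: lenw)
    then have "stable_rank w t = card ?U"
      by (simp only: stable_rank_def)
    also have "\<dots> = card ((!) \<gamma> ` ?U)"
      by (rule card_image[symmetric], rule inj_on_nth[OF d]) simp
    also have "(!) \<gamma> ` ?U = {c \<in> set \<gamma>. c < \<gamma> ! t}"
      by (auto simp: set_conv_nth)
    also have "\<dots> = {2..<\<gamma> ! t}"
      using t2 unfolding set\<gamma> by auto
    finally have "stable_rank w t = \<gamma> ! t - 2" by simp
    moreover have "2 \<le> \<gamma> ! t" using t2 by simp
    moreover have "shuffle_of_word w ! t = 2 + stable_rank w t" using t by (simp only: nth_shuffle_of_word lenw)
    ultimately show "shuffle_of_word w ! t = \<gamma> ! t" by linarith
  qed
  then show ?thesis using imageI[OF \<open>w \<in> words b\<close>, of shuffle_of_word] by (simp only:)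
qed

lemma bij_betw_shuffle_of_word:
  assumes b: "b \<in> compositions {1..a} (n - 1)" and "n \<ge> 1"
  shows "bij_betw shuffle_of_word (words b) (interleavings n a b)"
  unfolding bij_betw_def
proof (intro conjI equalityI subsetI)
  show "inj_on shuffle_of_word (words b)" using b by (rule inj_on_shuffle_of_word)
next
  fix \<gamma> assume "\<gamma> \<in> shuffle_of_word ` words b"
  then obtain w where w: "w \<in> words b" "\<gamma> = shuffle_of_word w" by blast
  note wc = words_compositions[OF w(1) b finite_atLeastAtMost]
  show "\<gamma> \<in> interleavings n a b"
    unfolding interleavings_def w(2)
  proof (intro CollectI conjI ballI)
    show "shuffle_of_word w \<in> permutations_of_set {2..n}"
      using shuffle_of_word_in_permutations[of w] wc(2) \<open>n \<ge> 1\<close> by simp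
    have "count (mset w) = b" using w(1) by (simp add: words_def)
    then show "subseq (pile b s) (shuffle_of_word w)" if "s \<in> {1..a}" for s
      using subseq_pile_shuffle_of_word[OF wc(1)] that by simp
  qed
qed (rule shuffle_of_word_surj[OF assms])

section \<open>The shuffle as an image of independent letters\<close>

text \<open>A single letter drawn from the finite alphabet \<open>S\<close> with probabilities \<open>p\<close>; meaningful only if \<open>p\<close> is a
  probability vector on \<open>S\<close>.\<close>

definition letter_pmf :: "'s set \<Rightarrow> ('s \<Rightarrow> real) \<Rightarrow> 's pmf" where
  "letter_pmf S p = embed_pmf (\<lambda>s. if s \<in> S then p s else 0)"

lemma pmf_letter_pmf:
  assumes "finite S" "\<And>s. s \<in> S \<Longrightarrow> 0 \<le> p s" "sum p S = 1"
  shows "pmf (letter_pmf S p) s = (if s \<in> S then p s else 0)"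
  unfolding letter_pmf_def
proof (rule pmf_embed_pmf)
  have "(\<integral>\<^sup>+s. ennreal (if s \<in> S then p s else 0) \<partial>count_space UNIV)
      = (\<integral>\<^sup>+s. ennreal (if s \<in> S then p s else 0) \<partial>count_space S)"
    by (rule nn_integral_count_space_eq) auto
  also have "\<dots> = ennreal (sum p S)"
    using assms by (simp add: nn_integral_count_space_finite)
  also have "\<dots> = 1"
    using assms(3) by simp
  finally show "(\<integral>\<^sup>+s. ennreal (if s \<in> S then p s else 0) \<partial>count_space UNIV) = 1" .
qed (use assms in auto)

lemma set_letter_pmf:
  assumes "finite S" "\<And>s. s \<in> S \<Longrightarrow> 0 \<le> p s" "sum p S = 1"
  shows "set_pmf (letter_pmf S p) \<subseteq> S"
proof
  fix s assume "s \<in> set_pmf (letter_pmf S p)"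
  then show "s \<in> S"
    using pmf_letter_pmf[OF assms, of s] by (auto simp: set_pmf_iff split: if_splits)
qed

lemma replicate_pmf_Suc_map:
  "replicate_pmf (Suc n) X = X \<bind> (\<lambda>x. map_pmf ((#) x) (replicate_pmf n X))"
  by (simp add: map_pmf_def)

lemma pmf_replicate_pmf:
  "pmf (replicate_pmf n X) xs = (if length xs = n then \<Prod>x\<leftarrow>xs. pmf X x else 0)"
proof (cases "length xs = n")
  case False
  then have "xs \<notin> set_pmf (replicate_pmf n X)"
    by (simp add: set_replicate_pmf)
  then show ?thesis using False by (simp add: set_pmf_iff)
next
  case True
  then show ?thesis
  proof (induction xs arbitrary: n)
    case (Cons x xs)
    have "replicate_pmf (Suc (length xs)) X
        = map_pmf (\<lambda>(x, xs). x # xs) (pair_pmf X (replicate_pmf (length xs) X))"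
      by (simp add: pair_pmf_def map_pmf_def bind_assoc_pmf bind_return_pmf)
    moreover have "inj (\<lambda>(x, xs). x # xs)"
      by (auto simp: inj_on_def)
    ultimately have "pmf (replicate_pmf (Suc (length xs)) X) (x # xs)
        = pmf (pair_pmf X (replicate_pmf (length xs) X)) (x, xs)"
      using pmf_map_inj'[of "\<lambda>(x, xs). x # xs" _ "(x, xs)"] by (simp only: prod.case)
    then show ?case
      using Cons by (auto simp: pmf_pair)
  qed simp
qed

lemma count_in_compositions_iff:
  assumes "finite S"
  shows "count (mset w) \<in> compositions S m \<longleftrightarrow> set w \<subseteq> S \<and> length w = m"
proof
  assume "count (mset w) \<in> compositions S m"
  then show "set w \<subseteq> S \<and> length w = m"
    using words_compositions[of w "count (mset w)" S m] assms by (simp add: words_def)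
next
  assume w: "set w \<subseteq> S \<and> length w = m"
  have "(\<Sum>s\<in>S. count (mset w) s) = (\<Sum>s\<in>set w. count (mset w) s)"
    using w assms by (intro sum.mono_neutral_right) auto
  also have "\<dots> = length w"
    by (simp add: size_multiset_overloaded_eq flip: size_mset)
  finally show "count (mset w) \<in> compositions S m"
    using w by (auto simp: compositions_def)
qed

lemma card_words:
  assumes b: "b \<in> compositions S m" and "finite S"
  shows "card (words b) * (\<Prod>s\<in>S. fact (b s)) = fact m" "finite (words b)" "words b \<noteq> {}"
proof -
  define A where "A = Abs_multiset b"
  have "finite {x. 0 < b x}"
    by (rule finite_subset[OF _ \<open>finite S\<close>]) (use b in \<open>auto simp: compositions_def\<close>)
  then have A: "count A = b"
    by (simp add: A_def)
  have words: "words b = permutations_of_multiset A"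
    by (auto simp: words_def permutations_of_multiset_def multiset_eq_iff A)
  have sub: "set_mset A \<subseteq> S"
    using b by (auto simp: compositions_def simp flip: A count_greater_zero_iff)
  have "size A = sum b S"
    unfolding size_multiset_overloaded_eq A
    using sub \<open>finite S\<close> by (intro sum.mono_neutral_left) (auto simp: not_in_iff A)
  then have "size A = m" using b by (simp add: compositions_def)
  moreover have "(\<Prod>s\<in>set_mset A. fact (b s)) = (\<Prod>s\<in>S. fact (b s) :: nat)"
    using sub \<open>finite S\<close> by (intro prod.mono_neutral_left) (auto simp: not_in_iff A)
  ultimately show "card (words b) * (\<Prod>s\<in>S. fact (b s)) = fact m"
    using card_permutations_of_multiset_aux[of A] by (simp add: words A)
  show "finite (words b)" "words b \<noteq> {}"
    by (simp_all add: words)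
qed

lemma prod_list_letters:
  fixes p :: "'s \<Rightarrow> real"
  assumes "finite S" "set w \<subseteq> S"
  shows "(\<Prod>x\<leftarrow>w. p x) = (\<Prod>s\<in>S. p s ^ count (mset w) s)"
  using assms(2)
proof (induction w)
  case (Cons x w)
  have "(\<Prod>s\<in>S. p s ^ count (mset (x # w)) s)
      = (\<Prod>s\<in>S. (if s = x then p s else 1) * p s ^ count (mset w) s)"
    by (intro prod.cong) auto
  also have "\<dots> = p x * (\<Prod>s\<in>S. p s ^ count (mset w) s)"
    using Cons.prems assms(1) by (simp add: prod.distrib)
  finally show ?case using Cons by simp
qed simp

text \<open>Choosing the content of a word by the multinomial distribution, and then the word uniformly
  among those of this content, produces independent letters.\<close>

lemma multinomial_mixture_of_words:
  assumes p: "finite S" "\<And>s. s \<in> S \<Longrightarrow> 0 \<le> p s" "sum p S = 1"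
  shows "multinomial_pmf S m p \<bind> (\<lambda>b. pmf_of_set (words b)) = replicate_pmf m (letter_pmf S p)"
proof (rule pmf_eqI)
  fix w :: "'a list"
  let ?c = "count (mset w)"
  have "pmf (multinomial_pmf S m p \<bind> (\<lambda>b. pmf_of_set (words b))) w
      = (\<Sum>b\<in>compositions S m. pmf (pmf_of_set (words b)) w * multinomial_mass S m p b)"
    unfolding pmf_bind
    by (subst integral_measure_pmf_real[of "compositions S m"])
      (auto simp: finite_compositions p pmf_multinomial_pmf set_pmf_iff multinomial_mass_def split: if_splits)
  also have "\<dots> = (\<Sum>b\<in>compositions S m.
      if b = ?c then multinomial_mass S m p ?c / real (card (words ?c)) else 0)"
  proof (rule sum.cong[OF refl])
    fix b assume b: "b \<in> compositions S m"
    have "w \<in> words b \<longleftrightarrow> b = ?c" by (auto simp: words_def)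
    then show "pmf (pmf_of_set (words b)) w * multinomial_mass S m p b
        = (if b = ?c then multinomial_mass S m p ?c / real (card (words ?c)) else 0)"
      using card_words(2,3)[OF b p(1)] by (simp add: pmf_of_set indicator_def)
  qed
  also have "\<dots> = (if ?c \<in> compositions S m then multinomial_mass S m p ?c / real (card (words ?c)) else 0)"
    by (simp add: finite_compositions p(1))
  also have "\<dots> = pmf (replicate_pmf m (letter_pmf S p)) w"
  proof (cases "?c \<in> compositions S m")
    case True
    then have w: "set w \<subseteq> S" "length w = m"
      using count_in_compositions_iff[OF p(1)] by blast+
    have "fact m = real (card (words ?c)) * (\<Prod>s\<in>S. fact (?c s))"
      using arg_cong[OF card_words(1)[OF True p(1)], of real] by simp
    moreover have "real (card (words ?c)) \<noteq> 0"
      using card_words(2,3)[OF True p(1)] by simp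
    moreover have "(\<Prod>s\<in>S. fact (?c s)) \<noteq> (0::real)"
      using p(1) by simp
    ultimately have "multinomial_mass S m p ?c / real (card (words ?c)) = (\<Prod>s\<in>S. p s ^ ?c s)"
      using True by (simp add: multinomial_mass_def)
    also have "\<dots> = (\<Prod>x\<leftarrow>w. p x)"
      using prod_list_letters[OF p(1) w(1)] by simp
    also have "\<dots> = (\<Prod>x\<leftarrow>w. pmf (letter_pmf S p) x)"
      by (intro arg_cong[of _ _ prod_list] map_cong refl) (use w(1) pmf_letter_pmf[OF p] in auto)
    finally show ?thesis
      using True w(2) by (simp add: pmf_replicate_pmf)
  next
    case False
    then have "w \<notin> set_pmf (replicate_pmf m (letter_pmf S p))"
      using count_in_compositions_iff[OF p(1)] set_letter_pmf[OF p] by (auto simp: set_replicate_pmf)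
    then show ?thesis
      using False by (simp add: set_pmf_iff)
  qed
  finally show "pmf (multinomial_pmf S m p \<bind> (\<lambda>b. pmf_of_set (words b))) w
      = pmf (replicate_pmf m (letter_pmf S p)) w" .
qed

lemma riffle_shuffle_pmf_eq_map_words:
  assumes p: "\<And>s. s \<in> {1..a} \<Longrightarrow> 0 \<le> p s" "sum p {1..a} = 1" and "n \<ge> 1"
  shows "riffle_shuffle_pmf a p n
           = map_pmf shuffle_of_word (replicate_pmf (n - 1) (letter_pmf {1..a} p))"
proof -
  have "riffle_shuffle_pmf a p n
      = multinomial_pmf {1..a} (n - 1) p \<bind> (\<lambda>b. map_pmf shuffle_of_word (pmf_of_set (words b)))"
    unfolding riffle_shuffle_pmf_def
  proof (rule bind_pmf_cong[OF refl])
    fix b assume "b \<in> set_pmf (multinomial_pmf {1..a} (n - 1) p)"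
    then have b: "b \<in> compositions {1..a} (n - 1)"
      using pmf_multinomial_pmf[OF _ p, of "n - 1" b]
      by (auto simp: set_pmf_iff multinomial_mass_def split: if_splits)
    show "pmf_of_set (interleavings n a b) = map_pmf shuffle_of_word (pmf_of_set (words b))"
      using map_pmf_of_set_bij_betw[OF bij_betw_shuffle_of_word[OF b \<open>n \<ge> 1\<close>]]
        card_words(2,3)[OF b finite_atLeastAtMost] by simp
  qed
  also have "\<dots> = map_pmf shuffle_of_word (replicate_pmf (n - 1) (letter_pmf {1..a} p))"
    using multinomial_mixture_of_words[OF _ p, of "n - 1"] by (simp flip: map_bind_pmf)
  finally show ?thesis .
qed

section \<open>The expected number of nodes\<close>

lemma finite_set_replicate_pmf:
  assumes "finite (set_pmf X)"
  shows "finite (set_pmf (replicate_pmf n X))"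
proof -
  have "set_pmf (replicate_pmf n X) = {xs. set xs \<subseteq> set_pmf X \<and> length xs = n}"
    by (auto simp: set_replicate_pmf)
  then show ?thesis using finite_lists_length_eq[OF assms, of n] by simp
qed

lemma expectation_replicate_pmf_Suc:
  fixes h :: "'a list \<Rightarrow> real"
  assumes "finite (set_pmf X)"
  shows "measure_pmf.expectation (replicate_pmf (Suc n) X) h
           = measure_pmf.expectation X (\<lambda>x. measure_pmf.expectation (replicate_pmf n X) (\<lambda>xs. h (x # xs)))"
proof -
  have "measure_pmf.expectation (replicate_pmf (Suc n) X) h
      = (\<Sum>x\<in>set_pmf X. pmf X x *\<^sub>R measure_pmf.expectation (map_pmf ((#) x) (replicate_pmf n X)) h)"
    unfolding replicate_pmf_Suc_map
    by (rule pmf_expectation_bind) (simp_all add: assms finite_set_replicate_pmf)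
  also have "\<dots> = measure_pmf.expectation X (\<lambda>x. measure_pmf.expectation (replicate_pmf n X) (\<lambda>xs. h (x # xs)))"
    by (subst integral_measure_pmf[of "set_pmf X" X]) (simp_all add: assms)
  finally show ?thesis .
qed

lemma expectation_of_bool:
  "measure_pmf.expectation X (\<lambda>x. of_bool (Q x)) = measure_pmf.prob X {x. Q x}"
proof -
  have "(\<lambda>x. of_bool (Q x)) = (indicator {x. Q x} :: _ \<Rightarrow> real)"
    by (auto simp: fun_eq_iff)
  then show ?thesis by simp
qed

lemma expectation_initial_letters:
  assumes "finite (set_pmf X)" "k \<le> n"
  shows "measure_pmf.expectation (replicate_pmf n X) (\<lambda>xs. of_bool (\<forall>y\<in>set (take k xs). Q y))
           = measure_pmf.prob X {x. Q x} ^ k"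
  using assms(2)
proof (induction k arbitrary: n)
  case (Suc k)
  then obtain m where m: "n = Suc m" "k \<le> m" by (cases n) auto
  have "measure_pmf.expectation (replicate_pmf n X) (\<lambda>xs. of_bool (\<forall>y\<in>set (take (Suc k) xs). Q y))
      = measure_pmf.expectation X (\<lambda>x. measure_pmf.expectation (replicate_pmf m X)
          (\<lambda>xs. of_bool (Q x) * of_bool (\<forall>y\<in>set (take k xs). Q y) :: real))"
    unfolding m expectation_replicate_pmf_Suc[OF assms(1)] by (simp flip: of_bool_conj)
  also have "\<dots> = measure_pmf.expectation X (\<lambda>x. of_bool (Q x)) * measure_pmf.prob X {x. Q x} ^ k"
    using Suc.IH[OF m(2)] by simp
  finally show ?case
    by (simp add: expectation_of_bool)
qed simp

text \<open>By induction on the length: prepending a letter \<open>x\<close> adds one start position precisely if there are at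
  least \<open>k\<close> further letters and the first \<open>k\<close> of them are related to \<open>x\<close>.  The subtraction is truncated,
  which gives \<open>0\<close> for words that are too short.\<close>

lemma expectation_card_run_starts:
  assumes fin: "finite (set_pmf X)"
  shows "measure_pmf.expectation (replicate_pmf n X) (\<lambda>xs. real (card (run_starts R k xs)))
           = real (n - k) * measure_pmf.expectation X (\<lambda>x. measure_pmf.prob X {y. R x y} ^ k)"
proof (induction n)
  case 0
  have "run_starts R k [] = {}" by (simp add: run_starts_def)
  then show ?case by simp
next
  case (Suc n)
  let ?M = "replicate_pmf n X"
  let ?q = "measure_pmf.expectation X (\<lambda>x. measure_pmf.prob X {y. R x y} ^ k)"
  note int = integrable_measure_pmf_finite[OF finite_set_replicate_pmf[OF fin]]
    integrable_measure_pmf_finite[OF fin]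
  let ?c = "\<lambda>x xs. of_bool (k \<le> n) * of_bool (\<forall>y\<in>set (take k xs). R x y) :: real"
  have step: "measure_pmf.expectation ?M (\<lambda>xs. real (card (run_starts R k (x # xs))))
      = of_bool (k \<le> n) * measure_pmf.prob X {y. R x y} ^ k
          + measure_pmf.expectation ?M (\<lambda>xs. real (card (run_starts R k xs)))" for x
  proof -
    have "measure_pmf.expectation ?M (\<lambda>xs. real (card (run_starts R k (x # xs))))
        = measure_pmf.expectation ?M (\<lambda>xs. ?c x xs + real (card (run_starts R k xs)))"
      by (rule integral_cong_AE)
        (auto simp: AE_measure_pmf_iff set_replicate_pmf card_run_starts_Cons)
    also have "\<dots> = measure_pmf.expectation ?M (?c x)
        + measure_pmf.expectation ?M (\<lambda>xs. real (card (run_starts R k xs)))"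
      by (rule Bochner_Integration.integral_add) (rule int)+
    also have "measure_pmf.expectation ?M (?c x) = of_bool (k \<le> n) * measure_pmf.prob X {y. R x y} ^ k"
      using expectation_initial_letters[OF fin, of k n "R x"] by (cases "k \<le> n") simp_all
    finally show ?thesis .
  qed
  have "measure_pmf.expectation (replicate_pmf (Suc n) X) (\<lambda>xs. real (card (run_starts R k xs)))
      = measure_pmf.expectation X (\<lambda>x. of_bool (k \<le> n) * measure_pmf.prob X {y. R x y} ^ k
          + real (n - k) * ?q)"
    unfolding expectation_replicate_pmf_Suc[OF fin] step Suc.IH ..
  also have "\<dots> = of_bool (k \<le> n) * ?q + real (n - k) * ?q"
    by (subst Bochner_Integration.integral_add) (simp_all add: int)
  also have "\<dots> = real (Suc n - k) * ?q"
    by (cases "k \<le> n") (simp_all add: Suc_diff_le algebra_simps)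
  finally show ?case .
qed

lemma expectation_num_ge_descendants:
  assumes p: "\<And>s. s \<in> {1..a} \<Longrightarrow> 0 \<le> p s" "sum p {1..a} = 1" and n: "n \<ge> 1" "k \<le> n - 1"
  shows "measure_pmf.expectation (brt_pmf a p n) (\<lambda>T. real (num_ge_descendants k n T))
           = (real n - real k - 1) * (\<Sum>s=1..a. p s * (\<Sum>r=s..a. p r) ^ k) + 1"
proof -
  let ?X = "letter_pmf {1..a} p"
  let ?W = "replicate_pmf (n - 1) ?X"
  have X: "pmf ?X s = (if s \<in> {1..a} then p s else 0)" for s
    by (rule pmf_letter_pmf) (use p in auto)
  have supp: "set_pmf ?X \<subseteq> {1..a}"
    by (rule set_letter_pmf) (use p in auto)
  have fin: "finite (set_pmf ?X)"
    by (rule finite_subset[OF supp finite_atLeastAtMost])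
  have tail: "measure_pmf.prob ?X {y. s \<le> y} = (\<Sum>r=s..a. p r)" if "s \<in> {1..a}" for s
  proof -
    have "measure_pmf.prob ?X {y. s \<le> y} = measure_pmf.prob ?X {s..a}"
      using supp by (intro measure_prob_cong_0) (auto simp: set_pmf_iff)
    also have "\<dots> = (\<Sum>r=s..a. p r)"
      unfolding measure_measure_pmf_finite[OF finite_atLeastAtMost]
    proof (rule sum.cong[OF refl])
      fix r assume "r \<in> {s..a}"
      then have "r \<in> {1..a}" using that by auto
      then show "pmf ?X r = p r" by (simp only: X if_True)
    qed
    finally show ?thesis .
  qed
  have "measure_pmf.expectation (brt_pmf a p n) (\<lambda>T. real (num_ge_descendants k n T))
      = measure_pmf.expectation ?W (\<lambda>w. real (num_ge_descendants k n (brt_tree n (shuffle_of_word w))))"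
  proof -
    have "riffle_shuffle_pmf a p n = map_pmf shuffle_of_word ?W"
      using p n(1) by (rule riffle_shuffle_pmf_eq_map_words)
    then show ?thesis by (simp only: brt_pmf_def integral_map_pmf)
  qed
  also have "\<dots> = measure_pmf.expectation ?W (\<lambda>w. 1 + real (card (run_starts (\<le>) k w)))"
  proof (intro integral_cong_AE)
    have "num_ge_descendants k n (brt_tree n (shuffle_of_word w)) = 1 + card (run_starts (\<le>) k w)"
      if "length w = n - 1" for w
      using num_ge_descendants_brt_tree[OF _ n, of "shuffle_of_word w"]
        shuffle_of_word_in_permutations[of w] that n(1)
      by (simp add: run_starts_shuffle_of_word)
    then show "AE w in ?W. real (num_ge_descendants k n (brt_tree n (shuffle_of_word w)))
        = 1 + real (card (run_starts (\<le>) k w))"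
      by (simp add: AE_measure_pmf_iff set_replicate_pmf)
  qed simp_all
  also have "\<dots> = 1 + measure_pmf.expectation ?W (\<lambda>w. real (card (run_starts (\<le>) k w)))"
    using integrable_measure_pmf_finite[OF finite_set_replicate_pmf[OF fin]]
    by (subst Bochner_Integration.integral_add) simp_all
  also have "measure_pmf.expectation ?W (\<lambda>w. real (card (run_starts (\<le>) k w)))
      = real (n - 1 - k) * measure_pmf.expectation ?X (\<lambda>x. measure_pmf.prob ?X {y. x \<le> y} ^ k)"
    by (rule expectation_card_run_starts[OF fin])
  also have "measure_pmf.expectation ?X (\<lambda>x. measure_pmf.prob ?X {y. x \<le> y} ^ k)
      = (\<Sum>s=1..a. p s * (\<Sum>r=s..a. p r) ^ k)"
  proof -
    have "measure_pmf.expectation ?X (\<lambda>x. measure_pmf.prob ?X {y. x \<le> y} ^ k)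
        = (\<Sum>s=1..a. measure_pmf.prob ?X {y. s \<le> y} ^ k * pmf ?X s)"
      by (rule integral_measure_pmf_real) (use supp in auto)
    also have "\<dots> = (\<Sum>s=1..a. p s * (\<Sum>r=s..a. p r) ^ k)"
      by (intro sum.cong refl) (simp only: tail X if_True mult.commute)
    finally show ?thesis .
  qed
  also have "real (n - 1 - k) = real n - real k - 1"
    using n by simp
  finally show ?thesis by simp
qed

section \<open>The uniform case\<close>

text \<open>Both bounds telescope from
  \<open>(k + 1) a\<^sup>k \<le> (a + 1)\<^sup>k\<^sup>+\<^sup>1 - a\<^sup>k\<^sup>+\<^sup>1 \<le> (k + 1) (a + 1)\<^sup>k\<close>.\<close>

lemma sum_power_bounds:
  "real a ^ Suc k \<le> real (Suc k) * (\<Sum>s=1..a. real s ^ k)"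
  "real (Suc k) * (\<Sum>s=1..a. real s ^ k) \<le> real a ^ Suc k + real (Suc k) * real a ^ k"
proof -
  have d: "real (Suc a) ^ Suc k - real a ^ Suc k = (\<Sum>i<Suc k. real (Suc a) ^ i * real a ^ (k - i))" for a
    using power_diff_sumr2[of "real (Suc a)" "Suc k" "real a"] by (simp add: mult.commute)
  have up: "real (Suc a) ^ Suc k - real a ^ Suc k \<le> real (Suc k) * real (Suc a) ^ k" for a
  proof -
    have "(\<Sum>i<Suc k. real (Suc a) ^ i * real a ^ (k - i)) \<le> (\<Sum>i<Suc k. real (Suc a) ^ i * real (Suc a) ^ (k - i))"
      by (intro sum_mono mult_left_mono power_mono) auto
    also have "\<dots> = (\<Sum>i<Suc k. real (Suc a) ^ k)"
      by (intro sum.cong refl) (simp flip: power_add)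
    finally show ?thesis unfolding d by simp
  qed
  have lo: "real (Suc k) * real a ^ k \<le> real (Suc a) ^ Suc k - real a ^ Suc k" for a
  proof -
    have "(\<Sum>i<Suc k. real a ^ k) = (\<Sum>i<Suc k. real a ^ i * real a ^ (k - i))"
      by (intro sum.cong refl) (simp flip: power_add)
    also have "\<dots> \<le> (\<Sum>i<Suc k. real (Suc a) ^ i * real a ^ (k - i))"
      by (intro sum_mono mult_right_mono power_mono) auto
    finally show ?thesis unfolding d by simp
  qed
  show "real a ^ Suc k \<le> real (Suc k) * (\<Sum>s=1..a. real s ^ k)"
  proof (induction a)
    case (Suc a)
    have "real (Suc k) * (\<Sum>s=1..Suc a. real s ^ k)
        = real (Suc k) * (\<Sum>s=1..a. real s ^ k) + real (Suc k) * real (Suc a) ^ k"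
      by (simp add: distrib_left)
    then show ?case using Suc up[of a] by linarith
  qed simp
  show "real (Suc k) * (\<Sum>s=1..a. real s ^ k) \<le> real a ^ Suc k + real (Suc k) * real a ^ k"
  proof (induction a)
    case (Suc a)
    have "real (Suc k) * (\<Sum>s=1..Suc a. real s ^ k)
        = real (Suc k) * (\<Sum>s=1..a. real s ^ k) + real (Suc k) * real (Suc a) ^ k"
      by (simp add: distrib_left)
    then show ?case using Suc lo[of a] by linarith
  qed simp
qed

lemma power_sum_limit:
  "(\<lambda>a. 1 / real a ^ (k + 1) * (\<Sum>s=1..a. real s ^ k)) \<longlonglongrightarrow> 1 / (real k + 1)"
proof (rule tendsto_sandwich)
  show "\<forall>\<^sub>F a in sequentially. 1 / (real k + 1) \<le> 1 / real a ^ (k + 1) * (\<Sum>s=1..a. real s ^ k)"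
  proof (rule eventually_sequentiallyI[of 1])
    fix a :: nat assume "1 \<le> a"
    then show "1 / (real k + 1) \<le> 1 / real a ^ (k + 1) * (\<Sum>s=1..a. real s ^ k)"
      using sum_power_bounds(1)[of a k] by (simp add: field_simps)
  qed
  show "\<forall>\<^sub>F a in sequentially. 1 / real a ^ (k + 1) * (\<Sum>s=1..a. real s ^ k) \<le> 1 / (real k + 1) + 1 / real a"
  proof (rule eventually_sequentiallyI[of 1])
    fix a :: nat assume "1 \<le> a"
    have "1 / real a ^ (k + 1) * (\<Sum>s=1..a. real s ^ k)
        = real (Suc k) * (\<Sum>s=1..a. real s ^ k) / (real (Suc k) * real a ^ Suc k)"
      by simp
    also have "\<dots> \<le> (real a ^ Suc k + real (Suc k) * real a ^ k) / (real (Suc k) * real a ^ Suc k)"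
      by (intro divide_right_mono sum_power_bounds(2)) simp
    also have "\<dots> = 1 / (real k + 1) + 1 / real a"
      using \<open>1 \<le> a\<close> by (simp add: add_divide_distrib add.commute)
    finally show "1 / real a ^ (k + 1) * (\<Sum>s=1..a. real s ^ k) \<le> 1 / (real k + 1) + 1 / real a" .
  qed
  have "(\<lambda>a. 1 / (real k + 1) + 1 / real a) \<longlonglongrightarrow> 1 / (real k + 1) + 0"
    by (intro tendsto_intros lim_1_over_n)
  then show "(\<lambda>a. 1 / (real k + 1) + 1 / real a) \<longlonglongrightarrow> 1 / (real k + 1)" by simp
qed simp

lemma uniform_tail_sum:
  assumes "a \<ge> 1"
  shows "(\<Sum>s=1..a. 1 / real a * (\<Sum>r=s..a. 1 / real a) ^ k) = 1 / real a ^ (k + 1) * (\<Sum>s=1..a. real s ^ k)"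
proof -
  have "(\<Sum>s=1..a. 1 / real a * (\<Sum>r=s..a. 1 / real a) ^ k)
      = (\<Sum>s=1..a. 1 / real a ^ (k + 1) * real (Suc a - s) ^ k)"
    by (intro sum.cong) (simp_all add: power_divide)
  also have "\<dots> = (\<Sum>s=1..a. 1 / real a ^ (k + 1) * real s ^ k)"
    by (subst sum.atLeastAtMost_rev) simp
  finally show ?thesis
    by (simp add: sum_distrib_left)
qed

theorem theorem4p1:
  fixes n k :: nat
  assumes "n \<ge> 2" and "k \<le> n - 1"
  shows "(\<forall>a\<ge>1. \<forall>p :: nat \<Rightarrow> real. (\<forall>s\<in>{1..a}. p s > 0) \<and> (\<Sum>s=1..a. p s) = 1 \<longrightarrow>
            measure_pmf.expectation (brt_pmf a p n) (\<lambda>T. real (num_ge_descendants k n T))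
              = (real n - real k - 1) * (\<Sum>s=1..a. p s * (\<Sum>r=s..a. p r) ^ k) + 1)
       \<and> (\<forall>a\<ge>2.
            measure_pmf.expectation (art_pmf a n) (\<lambda>T. real (num_ge_descendants k n T))
              = (real n - real k - 1) * (1 / real a ^ (k + 1)) * (\<Sum>s=1..a. real s ^ k) + 1)
       \<and> (\<lambda>a. measure_pmf.expectation (art_pmf a n) (\<lambda>T. real (num_ge_descendants k n T)))
            \<longlonglongrightarrow> real n / (real k + 1)"
proof (intro conjI allI impI)
  fix a :: nat and p :: "nat \<Rightarrow> real"
  assume "a \<ge> 1" "(\<forall>s\<in>{1..a}. p s > 0) \<and> (\<Sum>s=1..a. p s) = 1"
  then show "measure_pmf.expectation (brt_pmf a p n) (\<lambda>T. real (num_ge_descendants k n T))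
      = (real n - real k - 1) * (\<Sum>s=1..a. p s * (\<Sum>r=s..a. p r) ^ k) + 1"
    using assms by (intro expectation_num_ge_descendants) (auto intro: less_imp_le)
next
  have uniform: "measure_pmf.expectation (art_pmf a n) (\<lambda>T. real (num_ge_descendants k n T))
      = (real n - real k - 1) * (1 / real a ^ (k + 1) * (\<Sum>s=1..a. real s ^ k)) + 1" if "a \<ge> 1" for a
    unfolding art_pmf_def uniform_tail_sum[OF that, symmetric]
    using that assms by (intro expectation_num_ge_descendants) auto
  show "measure_pmf.expectation (art_pmf a n) (\<lambda>T. real (num_ge_descendants k n T))
      = (real n - real k - 1) * (1 / real a ^ (k + 1)) * (\<Sum>s=1..a. real s ^ k) + 1" if "a \<ge> 2" for a
    using uniform[of a] that by (simp only: mult.assoc)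
  have "(\<lambda>a. (real n - real k - 1) * (1 / real a ^ (k + 1) * (\<Sum>s=1..a. real s ^ k)) + 1)
      \<longlonglongrightarrow> (real n - real k - 1) * (1 / (real k + 1)) + 1"
    by (intro tendsto_intros power_sum_limit)
  also have "(real n - real k - 1) * (1 / (real k + 1)) + 1 = real n / (real k + 1)"
    by (simp add: field_simps)
  finally show "(\<lambda>a. measure_pmf.expectation (art_pmf a n) (\<lambda>T. real (num_ge_descendants k n T)))
      \<longlonglongrightarrow> real n / (real k + 1)"
    by (rule Lim_transform_eventually)
      (use uniform in \<open>auto intro!: eventually_sequentiallyI[of 1]\<close>)
qed

end
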